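(* Consider a planar polynomial system $$\frac{dx}{dt}=P(x,y),\qquad \frac{dy}{dt}=Q(x,y),$$ where $P$ and $Q$ are real polynomials of degree $m$. Let $P_m,Q_m$ be the homogeneous parts of degree exactly $m$ of $P,Q$, and put $$G_{m+1}(\theta)=\cos\theta\,Q_m(\cos\theta,\sin\theta)-\sin\theta\,P_m(\cos\theta,\sin\theta).$$ In polar coordinates, let $dr/dt$ and $d\theta/dt$ be of order $I$ and $J$ in $r$ as $r\to\infty$, respectively, and let $k=I-J$. (i) If $k\ge 2$, then the equator of the Poincaré sphere consists entirely of fixed points. (ii) If $k\le 1$, then: - if $G_{m+1}(\theta)\neq 0$ for all $\theta$, there is a cycle at infinity; if furthermore there is some $R$ such that $dr/dt\neq 0$ at all points with $r\ge R$, then this cycle is a limit cycle at infinity; - otherwise, the equator of the Poincaré sphere has finitely many fixed points, located at the angles $\theta$ such that $G_{m+1}(\theta)=0$.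
   Context: Degree: $m$ is the degree of the system, i.e. $m=\max(\deg P,\deg Q)$, so that $P_m,Q_m$ are not both zero (one of them may vanish). Orders $I,J$: for $r>0$, with $x=r\cos\theta$, $y=r\sin\theta$, the system takes the form $$\frac{dr}{dt}=\sum_{i=0}^{m} r^i\eta_i(\theta),\qquad \frac{d\theta}{dt}=\sum_{j=-1}^{m-1} r^j\xi_j(\theta),$$ where, with $P_i,Q_i$ the homogeneous parts of degree $i$ of $P,Q$, $\eta_i(\theta)=\cos\theta\,P_i(\cos\theta,\sin\theta)+\sin\theta\,Q_i(\cos\theta,\sin\theta)$ and $\xi_j(\theta)=\cos\theta\,Q_{j+1}(\cos\theta,\sin\theta)-\sin\theta\,P_{j+1}(\cos\theta,\sin\theta)$. $I$ is the largest $i$ with $\eta_i\not\equiv 0$ and $J$ is the largest $j$ with $\xi_j\not\equiv0$ (it is understood that $I$ and $J$ exist, i.e. neither $dr/dt$ nor $d\theta/dt$ vanishes identically). Behavior at infinity (Poincaré sphere): the phase plane is tangent to a sphere and is mapped to it by central projection from the center, antipodal points being identified; points at infinity of the plane correspond to points of the equator. The system is extended to the equator with the standard (Poincaré compactification) time rescaling, under which the equator is invariant, i.e. consists of trajectories and fixed points. Concretely, near the equator use coordinates $(s,\theta)$ with $s=1/r\ge 0$, so $x=\cos\theta/s$, $y=\sin\theta/s$, and new time $\tau$ with $dt=s^{m-1}d\tau$; the resulting vector field in $(s,\theta)$ extends smoothly to $s=0$ (the equator) with $ds/d\tau=0$ there. A fixed point at infinity is a zero of this extended field on $s=0$. There is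 a cycle at infinity if there are no fixed points at infinity (so that the equator is a closed orbit). The cycle at infinity is a limit cycle at infinity if all trajectories sufficiently near it approach it (or all recede from it, i.e. approach it in backward time). *)

theory Defs
  imports "HOL-Analysis.Analysis" "HOL-Computational_Algebra.Polynomial"
begin

text \<open>
  A real polynomial in two variables is an element of \<^typ>\<open>real poly poly\<close>: the coefficient of
  \<open>x ^ i * y ^ j\<close> in \<open>p\<close> is \<open>coeff (coeff p j) i\<close>.
\<close>

definition eval2 :: "real poly poly \<Rightarrow> real \<Rightarrow> real \<Rightarrow> real" where
  "eval2 p x y = poly (poly p [:y:]) x"

definition total_degree :: "real poly poly \<Rightarrow> nat" where
  "total_degree p = Max (insert 0 {i + j |i j. coeff (coeff p j) i \<noteq> 0})"

definition homogeneous_part :: "real poly poly \<Rightarrow> nat \<Rightarrow> real \<Rightarrow> real \<Rightarrow> real" where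
  "homogeneous_part p d x y = (\<Sum>j\<le>d. coeff (coeff p j) (d - j) * x ^ (d - j) * y ^ j)"

definition system_degree :: "real poly poly \<Rightarrow> real poly poly \<Rightarrow> nat" where
  "system_degree P Q = max (total_degree P) (total_degree Q)"

definition G_fun :: "real poly poly \<Rightarrow> real poly poly \<Rightarrow> real \<Rightarrow> real" where
  "G_fun P Q \<theta> =
     cos \<theta> * homogeneous_part Q (system_degree P Q) (cos \<theta>) (sin \<theta>)
     - sin \<theta> * homogeneous_part P (system_degree P Q) (cos \<theta>) (sin \<theta>)"


subsection \<open>The system in polar coordinates\<close>

text \<open>The values of \<open>dr/dt\<close> and \<open>d\<theta>/dt\<close> at the point with polar coordinates \<open>r > 0\<close> and \<open>\<theta>\<close>.\<close>

definition radial_speed :: "real poly poly \<Rightarrow> real poly poly \<Rightarrow> real \<Rightarrow> real \<Rightarrow> real" where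
  "radial_speed P Q r \<theta> =
     cos \<theta> * eval2 P (r * cos \<theta>) (r * sin \<theta>) + sin \<theta> * eval2 Q (r * cos \<theta>) (r * sin \<theta>)"

definition angular_speed :: "real poly poly \<Rightarrow> real poly poly \<Rightarrow> real \<Rightarrow> real \<Rightarrow> real" where
  "angular_speed P Q r \<theta> =
     (cos \<theta> * eval2 Q (r * cos \<theta>) (r * sin \<theta>) - sin \<theta> * eval2 P (r * cos \<theta>) (r * sin \<theta>)) / r"

definition eta :: "real poly poly \<Rightarrow> real poly poly \<Rightarrow> nat \<Rightarrow> real \<Rightarrow> real" where
  "eta P Q i \<theta> =
     cos \<theta> * homogeneous_part P i (cos \<theta>) (sin \<theta>) + sin \<theta> * homogeneous_part Q i (cos \<theta>) (sin \<theta>)"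

text \<open>Only the indices \<open>j \<ge> -1\<close> are meaningful.\<close>

definition xi :: "real poly poly \<Rightarrow> real poly poly \<Rightarrow> int \<Rightarrow> real \<Rightarrow> real" where
  "xi P Q j \<theta> =
     cos \<theta> * homogeneous_part Q (nat (j + 1)) (cos \<theta>) (sin \<theta>)
     - sin \<theta> * homogeneous_part P (nat (j + 1)) (cos \<theta>) (sin \<theta>)"

definition is_radial_order :: "real poly poly \<Rightarrow> real poly poly \<Rightarrow> nat \<Rightarrow> bool" where
  "is_radial_order P Q I \<longleftrightarrow>
     (\<exists>\<theta>. eta P Q I \<theta> \<noteq> 0) \<and> (\<forall>i>I. \<forall>\<theta>. eta P Q i \<theta> = 0)"

definition is_angular_order :: "real poly poly \<Rightarrow> real poly poly \<Rightarrow> int \<Rightarrow> bool" where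
  "is_angular_order P Q J \<longleftrightarrow>
     J \<ge> -1 \<and> (\<exists>\<theta>. xi P Q J \<theta> \<noteq> 0) \<and> (\<forall>j>J. \<forall>\<theta>. xi P Q j \<theta> = 0)"


subsection \<open>The system near the equator of the Poincare sphere\<close>

text \<open>
  In the coordinates \<open>(s, \<theta>)\<close> with \<open>s = 1 / r\<close> one has \<open>ds/dt = - s\<^sup>2 * dr/dt\<close>, and the time change
  \<open>dt = s ^ (m - 1) d\<tau>\<close> multiplies the field by \<open>s ^ (m - 1)\<close>; the exponent is \<open>-1\<close> if \<open>m = 0\<close>.
\<close>

definition rescaled_field :: "real poly poly \<Rightarrow> real poly poly \<Rightarrow> real \<times> real \<Rightarrow> real \<times> real" where
  "rescaled_field P Q = (\<lambda>(s, \<theta>).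
     (s powi (int (system_degree P Q) - 1)) *\<^sub>R
       (- (s\<^sup>2) * radial_speed P Q (1 / s) \<theta>, angular_speed P Q (1 / s) \<theta>))"

text \<open>
  The extension to the equator \<open>s = 0\<close> is the limit from the side \<open>s > 0\<close>; the limit exists and the
  extended field is continuous on \<open>s \<ge> 0\<close>, see \<open>extended_field_eq\<close> and
  \<open>continuous_on_extended_field\<close> below. Points with \<open>s < 0\<close> play no role.
\<close>

definition extended_field :: "real poly poly \<Rightarrow> real poly poly \<Rightarrow> real \<times> real \<Rightarrow> real \<times> real" where
  "extended_field P Q z =
     (if fst z = 0 then Lim (at z within {0<..} \<times> UNIV) (rescaled_field P Q)
      else rescaled_field P Q z)"

text \<open>
  A point of the equator is represented by a unit vector \<open>(cos \<theta>, sin \<theta>)\<close>; antipodal vectors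
  represent the same point at infinity of the plane.
\<close>

definition equator :: "(real \<times> real) set" where
  "equator = range (\<lambda>\<theta>. (cos \<theta>, sin \<theta>))"

definition fixed_points_at_infinity :: "real poly poly \<Rightarrow> real poly poly \<Rightarrow> (real \<times> real) set" where
  "fixed_points_at_infinity P Q = {(cos \<theta>, sin \<theta>) |\<theta>. extended_field P Q (0, \<theta>) = (0, 0)}"

definition cycle_at_infinity :: "real poly poly \<Rightarrow> real poly poly \<Rightarrow> bool" where
  "cycle_at_infinity P Q \<longleftrightarrow> fixed_points_at_infinity P Q = {}"

definition trajectory_on ::
  "real poly poly \<Rightarrow> real poly poly \<Rightarrow> real set \<Rightarrow> (real \<Rightarrow> real \<times> real) \<Rightarrow> bool" where
  "trajectory_on P Q T \<gamma> \<longleftrightarrow>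
     (\<forall>\<tau>\<in>T. fst (\<gamma> \<tau>) \<ge> 0 \<and>
            (\<gamma> has_vector_derivative extended_field P Q (\<gamma> \<tau>)) (at \<tau> within T))"

text \<open>
  The trajectory through a point approaches the equator if it exists for all (forward or
  backward) times and \<open>s\<close> tends to zero along it. Existence is part of the notion, so that
  trajectories which leave the domain in finite time do not count as approaching.
\<close>

definition approaches_equator_forward ::
  "real poly poly \<Rightarrow> real poly poly \<Rightarrow> real \<times> real \<Rightarrow> bool" where
  "approaches_equator_forward P Q z \<longleftrightarrow>
     (\<exists>\<gamma>. trajectory_on P Q {0..} \<gamma> \<and> \<gamma> 0 = z) \<and>
     (\<forall>\<gamma>. trajectory_on P Q {0..} \<gamma> \<and> \<gamma> 0 = z \<longrightarrow> ((\<lambda>\<tau>. fst (\<gamma> \<tau>)) \<longlongrightarrow> 0) at_top)"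

definition approaches_equator_backward ::
  "real poly poly \<Rightarrow> real poly poly \<Rightarrow> real \<times> real \<Rightarrow> bool" where
  "approaches_equator_backward P Q z \<longleftrightarrow>
     (\<exists>\<gamma>. trajectory_on P Q {..0} \<gamma> \<and> \<gamma> 0 = z) \<and>
     (\<forall>\<gamma>. trajectory_on P Q {..0} \<gamma> \<and> \<gamma> 0 = z \<longrightarrow> ((\<lambda>\<tau>. fst (\<gamma> \<tau>)) \<longlongrightarrow> 0) at_bot)"

definition limit_cycle_at_infinity :: "real poly poly \<Rightarrow> real poly poly \<Rightarrow> bool" where
  "limit_cycle_at_infinity P Q \<longleftrightarrow>
     cycle_at_infinity P Q \<and>
     (\<exists>\<epsilon>>0. (\<forall>s \<theta>. 0 < s \<and> s < \<epsilon> \<longrightarrow> approaches_equator_forward P Q (s, \<theta>)) \<or>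
            (\<forall>s \<theta>. 0 < s \<and> s < \<epsilon> \<longrightarrow> approaches_equator_backward P Q (s, \<theta>)))"


subsection \<open>Well-definedness of the extended field\<close>

lemma finite_monomials: "finite {i + j |i j. coeff (coeff (p :: real poly poly) j) i \<noteq> 0}"
proof (rule finite_subset)
  show "{i + j |i j. coeff (coeff p j) i \<noteq> 0}
      \<subseteq> (\<Union>j\<in>{..degree p}. \<Union>i\<in>{..degree (coeff p j)}. {i + j})"
  proof
    fix d assume "d \<in> {i + j |i j. coeff (coeff p j) i \<noteq> 0}"
    then obtain i j where d: "d = i + j" and c: "coeff (coeff p j) i \<noteq> 0"
      by blast
    from c have "i \<le> degree (coeff p j)" by (rule le_degree)
    moreover from c have "coeff p j \<noteq> 0" by (metis coeff_0)
    then have "j \<le> degree p" by (rule le_degree)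
    ultimately show "d \<in> (\<Union>j\<in>{..degree p}. \<Union>i\<in>{..degree (coeff p j)}. {i + j})"
      unfolding d by blast
  qed
qed simp

lemma coeff_eq_0_total_degree:
  assumes "i + j > total_degree p"
  shows "coeff (coeff p j) i = 0"
proof (rule ccontr)
  assume "coeff (coeff p j) i \<noteq> 0"
  then have "i + j \<in> insert 0 {i + j |i j. coeff (coeff p j) i \<noteq> 0}"
    by blast
  then have "i + j \<le> total_degree p"
    unfolding total_degree_def using finite_monomials by (intro Max_ge) simp_all
  with assms show False by simp
qed

lemma poly_eq_sum_upto: "degree (p :: 'a :: comm_semiring_1 poly) \<le> n \<Longrightarrow>
    poly p x = (\<Sum>i\<le>n. coeff p i * x ^ i)"
  unfolding poly_altdef by (rule sum.mono_neutral_left) (auto simp: coeff_eq_0)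

lemma eval2_homogeneous_parts:
  assumes "total_degree p \<le> n"
  shows "eval2 p x y = (\<Sum>d\<le>n. homogeneous_part p d x y)"
proof -
  have z: "coeff (coeff p j) i = 0" if "i + j > n" for i j
    using coeff_eq_0_total_degree[of p i j] that assms by simp
  have "degree p \<le> n"
    by (intro degree_le allI impI poly_eqI) (simp add: z)
  have dj: "degree (coeff p j) \<le> n - j" for j
    by (intro degree_le allI impI z) linarith
  have "eval2 p x y = (\<Sum>j\<le>n. poly (coeff p j) x * y ^ j)"
    unfolding eval2_def poly_eq_sum_upto[OF \<open>degree p \<le> n\<close>] by (simp add: poly_sum)
  also have "\<dots> = (\<Sum>j\<le>n. \<Sum>i\<le>n - j. coeff (coeff p j) i * x ^ i * y ^ j)"
    by (simp add: poly_eq_sum_upto[OF dj] sum_distrib_right)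
  also have "\<dots> = (\<Sum>(j, i)\<in>(SIGMA j:{..n}. {..n - j}). coeff (coeff p j) i * x ^ i * y ^ j)"
    by (simp add: sum.Sigma)
  also have "(SIGMA j:{..n}. {..n - j}) = {(j, i). j + i \<le> n}"
    by auto
  also have "(\<Sum>(j, i)\<in>{(j, i). j + i \<le> n}. coeff (coeff p j) i * x ^ i * y ^ j)
      = (\<Sum>d\<le>n. homogeneous_part p d x y)"
    unfolding homogeneous_part_def by (rule sum.triangle_reindex_eq)
  finally show ?thesis .
qed

lemma homogeneous_part_scale:
  "homogeneous_part p d (r * x) (r * y) = r ^ d * homogeneous_part p d x y"
proof -
  have *: "coeff (coeff p j) (d - j) * (r * x) ^ (d - j) * (r * y) ^ j
      = r ^ d * (coeff (coeff p j) (d - j) * x ^ (d - j) * y ^ j)" if "j \<le> d" for j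
  proof -
    have "r ^ d = r ^ (d - j) * r ^ j"
      using that power_add[of r "d - j" j] by simp
    then show ?thesis
      by (simp only: power_mult_distrib mult.assoc mult.commute mult.left_commute)
  qed
  show ?thesis
    unfolding homogeneous_part_def sum_distrib_left by (rule sum.cong[OF refl], rule *) simp
qed

lemma eval2_polar:
  assumes "total_degree p \<le> n"
  shows "eval2 p (r * x) (r * y) = (\<Sum>i\<le>n. r ^ i * homogeneous_part p i x y)"
  unfolding eval2_homogeneous_parts[OF assms] homogeneous_part_scale ..

lemma radial_speed_eq:
  "radial_speed P Q r \<theta> = (\<Sum>i\<le>system_degree P Q. r ^ i * eta P Q i \<theta>)"
proof -
  have "total_degree P \<le> system_degree P Q" "total_degree Q \<le> system_degree P Q"
    by (simp_all add: system_degree_def)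
  then show ?thesis
    unfolding radial_speed_def eta_def
    by (simp only: eval2_polar sum_distrib_left distrib_left sum.distrib mult.left_commute)
qed

lemma angular_speed_mult_eq:
  assumes "r \<noteq> 0"
  shows "r * angular_speed P Q r \<theta> = (\<Sum>i\<le>system_degree P Q. r ^ i * xi P Q (int i - 1) \<theta>)"
proof -
  have "total_degree P \<le> system_degree P Q" "total_degree Q \<le> system_degree P Q"
    by (simp_all add: system_degree_def)
  moreover have "nat (int i - 1 + 1) = i" for i
    by simp
  ultimately show ?thesis
    unfolding angular_speed_def xi_def times_divide_eq_right nonzero_mult_div_cancel_left[OF assms]
    by (simp only: eval2_polar sum_distrib_left right_diff_distrib sum_subtractf mult.left_commute)
qed

lemma angular_speed_eq:
  assumes "r > 0"
  shows "angular_speed P Q r \<theta>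
    = (\<Sum>j = -1..int (system_degree P Q) - 1. r powi j * xi P Q j \<theta>)"
proof -
  have "angular_speed P Q r \<theta>
      = (\<Sum>i\<le>system_degree P Q. r powi (int i - 1) * xi P Q (int i - 1) \<theta>)"
  proof -
    have "angular_speed P Q r \<theta> = (r * angular_speed P Q r \<theta>) / r"
      using assms by simp
    also have "\<dots> = (\<Sum>i\<le>system_degree P Q. r ^ i * xi P Q (int i - 1) \<theta> / r)"
      using assms by (simp only: angular_speed_mult_eq sum_divide_distrib)
    finally show ?thesis
      using assms by (simp add: power_int_diff)
  qed
  also have "\<dots> = (\<Sum>j = -1..int (system_degree P Q) - 1. r powi j * xi P Q j \<theta>)"
    by (rule sum.reindex_bij_witness[of _ "\<lambda>j. nat (j + 1)" "\<lambda>i. int i - 1"]) auto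
  finally show ?thesis .
qed

definition smooth_field :: "real poly poly \<Rightarrow> real poly poly \<Rightarrow> real \<times> real \<Rightarrow> real \<times> real" where
  "smooth_field P Q = (\<lambda>(s, \<theta>).
     (- (\<Sum>i\<le>system_degree P Q. s ^ (system_degree P Q + 1 - i) * eta P Q i \<theta>),
      \<Sum>i\<le>system_degree P Q. s ^ (system_degree P Q - i) * xi P Q (int i - 1) \<theta>))"

lemma rescaled_field_eq:
  assumes "s > 0"
  shows "rescaled_field P Q (s, \<theta>) = smooth_field P Q (s, \<theta>)"
proof -
  define m where "m = system_degree P Q"
  have pw: "s powi (int m - 1) = s ^ m / s"
    using assms by (simp add: power_int_diff)
  have q: "s ^ m * (1 / s) ^ i = s ^ (m - i)" if "i \<le> m" for i
    using assms that by (simp add: power_diff power_one_over)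
  have "s ^ m / s * (- (s\<^sup>2) * radial_speed P Q (1 / s) \<theta>)
      = - (\<Sum>i\<le>m. s * (s ^ m * (1 / s) ^ i) * eta P Q i \<theta>)"
  proof -
    have "s ^ m / s * (- (s\<^sup>2) * X) = - (s * s ^ m * X)" for X
      using assms by (simp add: power2_eq_square)
    then show ?thesis
      unfolding radial_speed_eq m_def[symmetric] by (simp only: sum_distrib_left sum_negf mult.assoc)
  qed
  also have "\<dots> = - (\<Sum>i\<le>m. s ^ (m + 1 - i) * eta P Q i \<theta>)"
    by (simp add: q Suc_diff_le)
  finally have 1: "s ^ m / s * (- (s\<^sup>2) * radial_speed P Q (1 / s) \<theta>)
      = - (\<Sum>i\<le>m. s ^ (m + 1 - i) * eta P Q i \<theta>)" .
  have "s ^ m / s * angular_speed P Q (1 / s) \<theta>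
      = s ^ m * (1 / s * angular_speed P Q (1 / s) \<theta>)"
    by simp
  also have "\<dots> = s ^ m * (\<Sum>i\<le>m. (1 / s) ^ i * xi P Q (int i - 1) \<theta>)"
    using assms by (subst angular_speed_mult_eq) (auto simp: m_def)
  also have "\<dots> = (\<Sum>i\<le>m. s ^ m * (1 / s) ^ i * xi P Q (int i - 1) \<theta>)"
    by (simp add: sum_distrib_left mult.assoc)
  also have "\<dots> = (\<Sum>i\<le>m. s ^ (m - i) * xi P Q (int i - 1) \<theta>)"
    by (rule sum.cong) (simp_all add: q)
  finally show ?thesis
    using 1 pw by (simp add: rescaled_field_def smooth_field_def flip: m_def)
qed

lemma continuous_on_smooth_field: "continuous_on A (smooth_field P Q)"
  unfolding smooth_field_def case_prod_unfold eta_def xi_def homogeneous_part_def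
  by (intro continuous_intros)

lemma extended_field_eq:
  assumes "fst z \<ge> 0"
  shows "extended_field P Q z = smooth_field P Q z"
proof (cases "fst z = 0")
  case True
  let ?H = "{0<..} \<times> UNIV :: (real \<times> real) set"
  have nt: "at z within ?H \<noteq> bot"
  proof -
    have "z \<in> closure ?H"
      using True by (cases z) (simp add: closure_Times)
    moreover have "z \<notin> ?H" using True by auto
    ultimately show ?thesis
      by (simp add: at_within_eq_bot_iff)
  qed
  have "(smooth_field P Q \<longlongrightarrow> smooth_field P Q z) (at z)"
    using continuous_on_smooth_field[of UNIV P Q] by (cases z) (simp add: continuous_on_def)
  then have "(smooth_field P Q \<longlongrightarrow> smooth_field P Q z) (at z within ?H)"
    by (rule tendsto_within_subset) auto
  then have "(rescaled_field P Q \<longlongrightarrow> smooth_field P Q z) (at z within ?H)"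
    by (rule Lim_transform_eventually)
       (auto simp: eventually_at_filter rescaled_field_eq intro!: always_eventually)
  with nt True show ?thesis
    by (simp add: extended_field_def tendsto_Lim)
next
  case False
  with assms show ?thesis
    by (cases z) (simp add: extended_field_def rescaled_field_eq)
qed

lemma continuous_on_extended_field: "continuous_on ({0..} \<times> UNIV) (extended_field P Q)"
  using continuous_on_smooth_field
  by (rule continuous_on_eq) (auto simp: extended_field_eq)

end

theory Submission
  imports Defs
begin

text \<open>
  In the coordinates \<open>(s, \<theta>)\<close> the extended field takes the value \<open>(0, G\<^sub>m\<^sub>+\<^sub>1(\<theta>))\<close> on the equator
  (\<open>smooth_field_equator\<close>), so the fixed points at infinity are always the zeros of \<open>G\<^sub>m\<^sub>+\<^sub>1\<close>. The number
  \<open>k = I - J\<close> only decides whether \<open>G\<^sub>m\<^sub>+\<^sub>1\<close> vanishes identically: since \<open>P\<^sub>m\<close> and \<open>Q\<^sub>m\<close> are not both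
  zero, the radial order is \<open>m\<close> or the angular order is \<open>m - 1\<close>, which gives \<open>G\<^sub>m\<^sub>+\<^sub>1 = 0\<close> if and only if
  \<open>k \<ge> 2\<close> (\<open>G_fun_identically_zero_iff\<close>). If \<open>G\<^sub>m\<^sub>+\<^sub>1\<close> is not identically zero, it is, up to a power of
  \<open>cos \<theta>\<close>, a nonzero polynomial in \<open>tan \<theta>\<close>, and its zeros on the circle are finite in number
  (\<open>finite_zeros_of_G_fun\<close>).

  For the limit cycle, suppose that \<open>dr/dt\<close> has no zero for large \<open>r\<close>. By connectedness it has a
  constant sign there, so, possibly after reversing time, \<open>s\<close> decreases along every trajectory
  near the equator. By compactness of the annuli \<open>e \<le> s \<le> c\<close> with \<open>e > 0\<close> the rate of decrease is bounded away
  from zero as long as \<open>s \<ge> e\<close>, which forces \<open>s\<close> to zero (\<open>solution_forward_tendsto_0\<close>).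

  It remains to see that the trajectories exist for all times. The field is polynomial in \<open>s\<close>
  and trigonometric in \<open>\<theta>\<close>; clamping \<open>s\<close> to a bounded interval makes it bounded and globally
  Lipschitz, and a Picard iteration in an exponentially weighted space yields a global solution
  (\<open>solution_of_bounded_Lipschitz_field\<close>). A barrier argument (\<open>above_barrier\<close>) shows that this solution
  stays where the clamping has no effect (\<open>solution_forward_exists\<close>).
\<close>

section \<open>Global solutions of bounded Lipschitz fields\<close>

lemma has_vector_derivative_integral_halfline:
  fixes g :: "real \<Rightarrow> 'a :: banach"
  assumes "continuous_on UNIV g" and "t \<ge> 0"
  shows "((\<lambda>t. integral {0..t} g) has_vector_derivative g t) (at t within {0..})"
proof -
  have "((\<lambda>t. integral {0..t} g) has_vector_derivative g t) (at t within {0..t + 1})"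
    using assms by (intro integral_has_vector_derivative) (auto intro: continuous_on_subset)
  moreover have "at t within {0..t + 1} = at t within {0..}"
    using assms by (intro at_within_nhd[of _ "{..<t + 1}"]) auto
  ultimately show ?thesis by simp
qed

text \<open>
  The Picard operator is a contraction on a whole half-line at once, without gluing local
  solutions, if a function \<open>x\<close> is encoded by \<open>u\<close> with \<open>x t = z + exp (2 * B * t) *\<^sub>R u t\<close>.
  With this exponential weight the Lipschitz constant \<open>B\<close> turns into the contraction factor
  \<open>1 / 2\<close>, and the bound on \<open>F\<close> makes every image of the operator a bounded function. The fixed
  point is supplied by Banach's theorem in the complete space of bounded continuous functions;
  these live on all of \<open>\<real>\<close>, hence the truncation \<open>max 0 t\<close>.
\<close>

lemma solution_of_bounded_Lipschitz_field:
  fixes F :: "'a :: banach \<Rightarrow> 'a"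
  assumes bound: "\<And>x. norm (F x) \<le> B"
    and lip: "\<And>x y. norm (F x - F y) \<le> B * norm (x - y)"
  obtains x where "x 0 = z"
    and "\<And>t. t \<ge> 0 \<Longrightarrow> (x has_vector_derivative F (x t)) (at t within {0..})"
proof -
  have "B \<ge> 0" using bound[of undefined] norm_ge_zero by (rule order_trans[rotated])
  have contF: "continuous_on UNIV F"
    using lip \<open>B \<ge> 0\<close>
    by (intro lipschitz_on_continuous_on[of B]) (auto simp: lipschitz_on_def dist_norm)
  define g where "g u s = F (z + exp (2 * B * s) *\<^sub>R apply_bcontfun u s)" for u s
  define T where "T u t = exp (- (2 * B * max 0 t)) *\<^sub>R integral {0..max 0 t} (g u)" for u t
  have cont_g: "continuous_on A (g u)" for u A
    unfolding g_def by (intro continuous_on_compose2[OF contF] continuous_intros) auto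
  have int_g: "g u integrable_on {a..b}" for u a b
    by (intro integrable_continuous_real cont_g)
  have cont_int: "continuous_on {0..} (\<lambda>t. integral {0..t} (g u))" for u
    unfolding continuous_on_eq_continuous_within
    by (auto intro!: has_vector_derivative_continuous has_vector_derivative_integral_halfline cont_g)
  have T_bcontfun: "T u \<in> bcontfun" for u
  proof (rule bcontfun_normI[where b = 1])
    show "continuous_on UNIV (T u)"
      unfolding T_def
      by (intro continuous_intros continuous_on_compose2[OF cont_int]) auto
    fix t :: real
    define r where "r = max 0 t"
    have "norm (integral {0..r} (g u)) \<le> B * (r - 0)"
      by (intro integral_bound cont_g) (auto simp: r_def g_def bound)
    moreover have "B * r \<le> exp (2 * B * r)"
    proof -
      have "0 \<le> B * r" using \<open>B \<ge> 0\<close> by (simp add: r_def)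
      then show ?thesis using exp_ge_add_one_self[of "2 * B * r"] by linarith
    qed
    ultimately show "norm (T u t) \<le> 1"
      by (simp add: T_def r_def[symmetric] exp_minus field_simps)
  qed
  have T_contraction: "dist (Bcontfun (T u)) (Bcontfun (T v)) \<le> 1 / 2 * dist u v" for u v
  proof (rule dist_bound)
    fix t :: real
    define r where "r = max 0 t"
    have "r \<ge> 0" by (simp add: r_def)
    define d where "d = dist u v"
    have exp_int: "((\<lambda>s. B * (exp (2 * B * s) * d)) has_integral
        exp (2 * B * r) * d / 2 - exp (2 * B * 0) * d / 2) {0..r}"
      using \<open>r \<ge> 0\<close>
      by (intro fundamental_theorem_of_calculus)
         (auto intro!: derivative_eq_intros simp flip: has_real_derivative_iff_has_vector_derivative)
    have "norm (integral {0..r} (g u) - integral {0..r} (g v))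
        = norm (integral {0..r} (\<lambda>s. g u s - g v s))"
      by (simp add: integral_diff int_g)
    \<comment> \<open>The integral of the weight is at most the weight over \<open>2 * B\<close>; this gains the factor \<open>1 / 2\<close>.\<close>
    also have "\<dots> \<le> integral {0..r} (\<lambda>s. B * (exp (2 * B * s) * d))"
    proof (rule integral_norm_bound_integral)
      fix s
      have "norm (g u s - g v s) \<le> B * norm (exp (2 * B * s) *\<^sub>R (u s - v s))"
        unfolding g_def using lip by (metis add_diff_cancel_left scaleR_diff_right)
      also have "\<dots> \<le> B * (exp (2 * B * s) * d)"
        using \<open>B \<ge> 0\<close> dist_bounded[of u s v]
        by (intro mult_left_mono) (auto simp: d_def dist_norm)
      finally show "norm (g u s - g v s) \<le> B * (exp (2 * B * s) * d)" .
    qed (use exp_int in \<open>auto intro!: integrable_diff int_g\<close>)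
    also have "\<dots> \<le> exp (2 * B * r) * (d / 2)"
      using integral_unique[OF exp_int] by (simp add: d_def)
    finally have "norm (integral {0..r} (g u) - integral {0..r} (g v)) \<le> exp (2 * B * r) * (d / 2)" .
    then have "exp (- (2 * B * r)) * norm (integral {0..r} (g u) - integral {0..r} (g v))
        \<le> exp (- (2 * B * r)) * (exp (2 * B * r) * (d / 2))"
      by (intro mult_left_mono) auto
    also have "\<dots> = d / 2"
      by (simp add: exp_minus)
    finally have "exp (- (2 * B * r)) * norm (integral {0..r} (g u) - integral {0..r} (g v)) \<le> d / 2" .
    moreover have "dist (T u t) (T v t)
        = exp (- (2 * B * r)) * norm (integral {0..r} (g u) - integral {0..r} (g v))"
      by (simp add: T_def r_def dist_norm flip: scaleR_diff_right)
    ultimately show "dist (apply_bcontfun (Bcontfun (T u)) t) (apply_bcontfun (Bcontfun (T v)) t)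
        \<le> 1 / 2 * dist u v"
      by (simp add: Bcontfun_inverse T_bcontfun d_def)
  qed
  have "\<exists>!u. Bcontfun (T u) = u"
    using T_contraction by (intro banach_fix_type[where c = "1 / 2"]) auto
  then obtain u where u: "Bcontfun (T u) = u" by auto
  define x where "x t = z + exp (2 * B * t) *\<^sub>R u t" for t
  have gu: "g u = (\<lambda>s. F (x s))"
    by (simp add: fun_eq_iff g_def x_def)
  have x_eq: "x t = z + integral {0..t} (g u)" if "t \<ge> 0" for t
  proof -
    have "u t = T u t" using u Bcontfun_inverse[OF T_bcontfun] by metis
    with that show ?thesis
      by (simp add: x_def T_def exp_minus)
  qed
  show thesis
  proof
    show "x 0 = z" using x_eq[of 0] by simp
    fix t :: real assume "t \<ge> 0"
    have "((\<lambda>t. z + integral {0..t} (g u)) has_vector_derivative 0 + g u t) (at t within {0..})"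
      using \<open>t \<ge> 0\<close>
      by (intro has_vector_derivative_add has_vector_derivative_const
            has_vector_derivative_integral_halfline cont_g)
    then show "(x has_vector_derivative F (x t)) (at t within {0..})"
      using \<open>t \<ge> 0\<close> x_eq
      by (simp add: gu) (rule has_vector_derivative_transform[rotated 2], assumption, auto)
  qed
qed

section \<open>A barrier principle\<close>

text \<open>
  A function cannot cross the level \<open>c\<close> downwards if it does not decrease in a thin strip just
  below \<open>c\<close>: otherwise take the last time \<open>a\<close> at which it is still at least \<open>c\<close> and apply the mean
  value theorem immediately after \<open>a\<close>. Only a strip is required, because a trajectory near the
  equator is controlled only as long as it stays near the equator.
\<close>

lemma above_barrier:
  fixes f f' :: "real \<Rightarrow> real"
  assumes deriv: "\<And>t. t \<ge> 0 \<Longrightarrow> (f has_real_derivative f' t) (at t within {0..})"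
    and "f 0 \<ge> c" and "\<delta> > 0"
    and nonneg: "\<And>t. t \<ge> 0 \<Longrightarrow> c - \<delta> < f t \<Longrightarrow> f t < c \<Longrightarrow> f' t \<ge> 0"
    and "t \<ge> 0"
  shows "f t \<ge> c"
proof (rule ccontr)
  assume "\<not> f t \<ge> c"
  have cont: "continuous_on {0..} f"
    using deriv by (auto simp: continuous_on_eq_continuous_within intro: DERIV_continuous)
  define A where "A = {0..t} \<inter> {u. f u \<ge> c}"
  have "compact A"
  proof -
    have "closed ({0..t} \<inter> f -` {c..})"
      by (intro continuous_closed_preimage continuous_on_subset[OF cont]) auto
    then show ?thesis
      unfolding A_def by (auto simp: compact_eq_bounded_closed vimage_def
          intro: bounded_subset[OF bounded_closed_interval[of 0 t]])
  qed
  moreover have "A \<noteq> {}" using assms by (auto simp: A_def)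
  ultimately obtain a where a: "a \<in> A" and a_max: "\<And>u. u \<in> A \<Longrightarrow> u \<le> a"
    using compact_attains_sup[of A] by blast
  have "0 \<le> a" "a < t" "f a \<ge> c"
    using a \<open>\<not> f t \<ge> c\<close> by (auto simp: A_def less_le)
  have below: "f u < c" if "a < u" "u \<le> t" for u
    using that a_max[of u] \<open>0 \<le> a\<close> by (force simp: A_def)
  have "continuous (at a within {0..}) f"
    using cont \<open>0 \<le> a\<close> by (auto simp: continuous_on_eq_continuous_within)
  then obtain d where "d > 0" and d: "\<And>u. u \<ge> 0 \<Longrightarrow> dist u a < d \<Longrightarrow> dist (f u) (f a) < \<delta>"
    using \<open>\<delta> > 0\<close> unfolding continuous_within_eps_delta by (metis atLeast_iff)
  \<comment> \<open>Just after \<open>a\<close> the function lies inside the strip.\<close>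
  define b where "b = min t (a + d / 2)"
  have "a < b" "b \<le> t" using \<open>a < t\<close> \<open>d > 0\<close> by (auto simp: b_def)
  have "\<exists>u\<in>{a<..<b}. f b - f a = f' u * (b - a)"
  proof (rule mvt_simple[OF \<open>a < b\<close>])
    fix u assume "a \<le> u" "u \<le> b"
    then have "(f has_derivative (*) (f' u)) (at u within {0..})"
      using deriv[of u] \<open>0 \<le> a\<close> by (simp add: has_field_derivative_def)
    then show "(f has_derivative (*) (f' u)) (at u within {a..b})"
      using \<open>0 \<le> a\<close> by (auto intro: has_derivative_subset)
  qed
  then obtain u where u: "a < u" "u < b" "f b - f a = f' u * (b - a)" by auto
  have "dist u a < d"
    using u \<open>d > 0\<close> by (auto simp: b_def dist_real_def)
  then have "c - \<delta> < f u"
    using d[of u] u \<open>0 \<le> a\<close> \<open>f a \<ge> c\<close> by (auto simp: dist_real_def)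
  then have "f' u \<ge> 0"
    using nonneg[of u] below[of u] u \<open>0 \<le> a\<close> \<open>b \<le> t\<close> by auto
  then have "f b \<ge> f a"
    using u \<open>a < b\<close> by (metis diff_ge_0_iff_ge less_imp_le mult_nonneg_nonneg)
  with below[of b] \<open>a < b\<close> \<open>b \<le> t\<close> \<open>f a \<ge> c\<close> show False by auto
qed

section \<open>Bounded Lipschitz functions\<close>

text \<open>
  Boundedness is carried along because products preserve Lipschitz continuity only for bounded
  factors, and because the Picard argument above relies on both properties.
\<close>

definition bounded_Lipschitz :: "('a :: metric_space \<Rightarrow> 'b :: real_normed_vector) \<Rightarrow> bool" where
  "bounded_Lipschitz f \<longleftrightarrow>
     (\<exists>B. \<forall>x. norm (f x) \<le> B \<and> (\<forall>y. norm (f x - f y) \<le> B * dist x y))"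

lemma bounded_LipschitzE:
  assumes "bounded_Lipschitz f"
  obtains B where "B \<ge> 0" "\<And>x. norm (f x) \<le> B" "\<And>x y. norm (f x - f y) \<le> B * dist x y"
proof -
  from assms obtain B where B: "\<And>x. norm (f x) \<le> B" "\<And>x y. norm (f x - f y) \<le> B * dist x y"
    unfolding bounded_Lipschitz_def by blast
  moreover have "B \<ge> 0" using B(1)[of undefined] norm_ge_zero by (rule order_trans[rotated])
  ultimately show thesis using that by blast
qed

lemma bounded_LipschitzI:
  assumes "\<And>x. norm (f x) \<le> B" "\<And>x y. norm (f x - f y) \<le> C * dist x y"
  shows "bounded_Lipschitz f"
  unfolding bounded_Lipschitz_def
proof (intro exI allI conjI)
  fix x y
  show "norm (f x) \<le> max B C" using assms(1) by (simp add: le_max_iff_disj)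
  show "norm (f x - f y) \<le> max B C * dist x y"
    by (rule order_trans[OF assms(2)]) (auto intro: mult_right_mono)
qed

lemma bounded_Lipschitz_const: "bounded_Lipschitz (\<lambda>_. c)"
  by (rule bounded_LipschitzI[of _ "norm c" 0]) auto

lemma bounded_Lipschitz_add:
  assumes "bounded_Lipschitz f" "bounded_Lipschitz g"
  shows "bounded_Lipschitz (\<lambda>x. f x + g x)"
proof -
  obtain B where B: "B \<ge> 0" "\<And>x. norm (f x) \<le> B" "\<And>x y. norm (f x - f y) \<le> B * dist x y"
    using bounded_LipschitzE[OF assms(1)] by blast
  obtain C where C: "C \<ge> 0" "\<And>x. norm (g x) \<le> C" "\<And>x y. norm (g x - g y) \<le> C * dist x y"
    using bounded_LipschitzE[OF assms(2)] by blast
  show ?thesis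
  proof (rule bounded_LipschitzI[of _ "B + C" "B + C"])
    fix x y
    show "norm (f x + g x) \<le> B + C" by (intro norm_triangle_mono B C)
    have "norm (f x + g x - (f y + g y)) \<le> norm (f x - f y) + norm (g x - g y)"
      by (rule norm_diff_triangle_ineq)
    also have "\<dots> \<le> (B + C) * dist x y"
      unfolding distrib_right by (intro add_mono B C)
    finally show "norm (f x + g x - (f y + g y)) \<le> (B + C) * dist x y" .
  qed
qed

lemma bounded_Lipschitz_mult:
  fixes f g :: "'a :: metric_space \<Rightarrow> real"
  assumes "bounded_Lipschitz f" "bounded_Lipschitz g"
  shows "bounded_Lipschitz (\<lambda>x. f x * g x)"
proof -
  obtain B where B: "B \<ge> 0" "\<And>x. norm (f x) \<le> B" "\<And>x y. norm (f x - f y) \<le> B * dist x y"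
    using bounded_LipschitzE[OF assms(1)] by blast
  obtain C where C: "C \<ge> 0" "\<And>x. norm (g x) \<le> C" "\<And>x y. norm (g x - g y) \<le> C * dist x y"
    using bounded_LipschitzE[OF assms(2)] by blast
  show ?thesis
  proof (rule bounded_LipschitzI[of _ "B * C" "2 * (B * C)"])
    fix x y
    show "norm (f x * g x) \<le> B * C"
      unfolding norm_mult by (intro mult_mono B C) auto
    have "norm (f x * g x - f y * g y) = norm ((f x - f y) * g x + f y * (g x - g y))"
      by (simp add: algebra_simps)
    also have "\<dots> \<le> norm (f x - f y) * norm (g x) + norm (f y) * norm (g x - g y)"
      by (metis norm_mult norm_triangle_ineq)
    also have "\<dots> \<le> (B * dist x y) * C + B * (C * dist x y)"
      by (intro add_mono mult_mono B C) (auto simp: B)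
    finally show "norm (f x * g x - f y * g y) \<le> 2 * (B * C) * dist x y"
      by (simp add: algebra_simps)
  qed
qed

lemma bounded_Lipschitz_minus: "bounded_Lipschitz f \<Longrightarrow> bounded_Lipschitz (\<lambda>x. - f x)"
  unfolding bounded_Lipschitz_def by (simp add: norm_minus_commute)

lemma bounded_Lipschitz_diff:
  "bounded_Lipschitz f \<Longrightarrow> bounded_Lipschitz g \<Longrightarrow> bounded_Lipschitz (\<lambda>x. f x - g x)"
  using bounded_Lipschitz_add[of f "\<lambda>x. - g x"] by (simp add: bounded_Lipschitz_minus)

lemma bounded_Lipschitz_power:
  "bounded_Lipschitz (f :: _ \<Rightarrow> real) \<Longrightarrow> bounded_Lipschitz (\<lambda>x. f x ^ n)"
  by (induction n) (auto intro: bounded_Lipschitz_mult bounded_Lipschitz_const)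

lemma bounded_Lipschitz_sum:
  "(\<And>i. i \<in> A \<Longrightarrow> bounded_Lipschitz (f i)) \<Longrightarrow> bounded_Lipschitz (\<lambda>x. \<Sum>i\<in>A. f i x)"
  by (induction A rule: infinite_finite_induct)
     (auto intro: bounded_Lipschitz_add bounded_Lipschitz_const)

lemma bounded_Lipschitz_Pair:
  assumes "bounded_Lipschitz f" "bounded_Lipschitz g"
  shows "bounded_Lipschitz (\<lambda>x. (f x, g x))"
proof -
  obtain B where B: "B \<ge> 0" "\<And>x. norm (f x) \<le> B" "\<And>x y. norm (f x - f y) \<le> B * dist x y"
    using bounded_LipschitzE[OF assms(1)] by blast
  obtain C where C: "C \<ge> 0" "\<And>x. norm (g x) \<le> C" "\<And>x y. norm (g x - g y) \<le> C * dist x y"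
    using bounded_LipschitzE[OF assms(2)] by blast
  show ?thesis
  proof (rule bounded_LipschitzI[of _ "B + C" "B + C"])
    fix x y
    show "norm (f x, g x) \<le> B + C"
      by (rule order_trans[OF norm_Pair_le add_mono[OF B(2) C(2)]])
    show "norm ((f x, g x) - (f y, g y)) \<le> (B + C) * dist x y"
      unfolding distrib_right diff_Pair
      by (rule order_trans[OF norm_Pair_le add_mono[OF B(3) C(3)]])
  qed
qed

text \<open>
  The clamped coordinate and the trigonometric functions of the angle are the
  building blocks from which the rules above assemble the clamped polar field.
\<close>

lemma bounded_Lipschitz_compose_snd:
  fixes f f' :: "real \<Rightarrow> real"
  assumes "\<And>x. (f has_real_derivative f' x) (at x)" "\<And>x. \<bar>f x\<bar> \<le> 1" "\<And>x. \<bar>f' x\<bar> \<le> 1"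
  shows "bounded_Lipschitz (\<lambda>z :: real \<times> real. f (snd z))"
proof (rule bounded_LipschitzI[of _ 1 1])
  fix x y :: "real \<times> real"
  show "norm (f (snd x)) \<le> 1" using assms(2) by simp
  have "norm (f (snd x) - f (snd y)) \<le> 1 * norm (snd x - snd y)"
    by (rule field_differentiable_bound[of UNIV f f' 1]) (use assms in auto)
  also have "norm (snd x - snd y) \<le> dist x y"
    unfolding dist_norm[symmetric] by (rule dist_snd_le)
  finally show "norm (f (snd x) - f (snd y)) \<le> 1 * dist x y" by simp
qed

lemma bounded_Lipschitz_sin_cos_snd:
  "bounded_Lipschitz (\<lambda>z :: real \<times> real. sin (snd z))"
  "bounded_Lipschitz (\<lambda>z :: real \<times> real. cos (snd z))"
  using bounded_Lipschitz_compose_snd[of sin cos]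
    bounded_Lipschitz_compose_snd[of cos "\<lambda>x. - sin x"] by auto

lemma bounded_Lipschitz_clamp_fst:
  fixes c :: real
  shows "bounded_Lipschitz (\<lambda>z :: real \<times> real. max 0 (min (fst z) c))"
proof (rule bounded_LipschitzI[of _ "\<bar>c\<bar>" 1])
  fix x y :: "real \<times> real"
  show "norm (max 0 (min (fst x) c)) \<le> \<bar>c\<bar>" by auto
  have "norm (max 0 (min (fst x) c) - max 0 (min (fst y) c)) \<le> dist (fst x) (fst y)"
    unfolding dist_real_def real_norm_def by linarith
  also have "\<dots> \<le> 1 * dist x y" using dist_fst_le[of x y] by simp
  finally show "norm (max 0 (min (fst x) c) - max 0 (min (fst y) c)) \<le> 1 * dist x y" .
qed

lemmas bounded_Lipschitz_intros = bounded_Lipschitz_const bounded_Lipschitz_add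
  bounded_Lipschitz_mult bounded_Lipschitz_minus bounded_Lipschitz_diff bounded_Lipschitz_power
  bounded_Lipschitz_sum bounded_Lipschitz_Pair bounded_Lipschitz_sin_cos_snd
  bounded_Lipschitz_clamp_fst

section \<open>Planar fields pointing towards the line s = 0\<close>

text \<open>
  Solutions in the closed half-plane \<open>s \<ge> 0\<close>. A general field \<open>V\<close> is allowed so that backward
  trajectories are covered by replacing the field with its negative.
\<close>

definition solution_forward :: "(real \<times> real \<Rightarrow> real \<times> real) \<Rightarrow> (real \<Rightarrow> real \<times> real) \<Rightarrow> bool" where
  "solution_forward V \<gamma> \<longleftrightarrow>
     (\<forall>t\<ge>0. fst (\<gamma> t) \<ge> 0 \<and> (\<gamma> has_vector_derivative V (\<gamma> t)) (at t within {0..}))"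

lemma has_real_derivative_fst:
  assumes "(\<gamma> has_vector_derivative v) F"
  shows "((\<lambda>t. fst (\<gamma> t)) has_real_derivative fst v) F"
proof -
  have "((\<lambda>t. fst (\<gamma> t)) has_derivative (\<lambda>h. fst (h *\<^sub>R v))) F"
    using assms unfolding has_vector_derivative_def by (rule has_derivative_fst)
  moreover have "(\<lambda>h. fst (h *\<^sub>R v)) = (*) (fst v)"
    by (simp add: fun_eq_iff mult.commute)
  ultimately show ?thesis by (simp add: has_field_derivative_def)
qed

text \<open>
  Clamping \<open>s\<close> to an interval makes the field globally Lipschitz, so a global
  solution exists. The clamped field does not push out of the strip between the equator and the
  initial level, by \<open>inv\<close> and \<open>inner\<close>; hence the solution never leaves it, and inside
  the strip the clamped field is the original one.
\<close>

lemma solution_forward_exists: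
  assumes lip: "bounded_Lipschitz (\<lambda>z. V (max 0 (min (fst z) s), snd z))"
    and inner: "\<And>\<theta>. fst (V (s, \<theta>)) \<le> 0" and inv: "\<And>\<theta>. fst (V (0, \<theta>)) = 0"
    and "s > 0"
  shows "\<exists>\<gamma>. solution_forward V \<gamma> \<and> \<gamma> 0 = (s, \<theta>)"
proof -
  define W where "W z = V (max 0 (min (fst z) s), snd z)" for z
  have "bounded_Lipschitz W"
    using lip by (simp add: W_def[abs_def])
  then obtain B where
    "B \<ge> 0" "\<And>x. norm (W x) \<le> B" "\<And>x y. norm (W x - W y) \<le> B * norm (x - y)"
    using bounded_LipschitzE[of W, unfolded dist_norm] by blast
  then obtain \<gamma> where \<gamma>0: "\<gamma> 0 = (s, \<theta>)"
    and \<gamma>: "\<And>t. t \<ge> 0 \<Longrightarrow> (\<gamma> has_vector_derivative W (\<gamma> t)) (at t within {0..})"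
    using solution_of_bounded_Lipschitz_field[of W B "(s, \<theta>)"] by metis
  note d = has_real_derivative_fst[OF \<gamma>]
  have "fst (\<gamma> t) \<ge> 0" if "t \<ge> 0" for t
    by (rule above_barrier[OF d, where \<delta> = 1]) (use that \<open>s > 0\<close> in \<open>auto simp: \<gamma>0 W_def inv\<close>)
  moreover have "- fst (\<gamma> t) \<ge> - s" if "t \<ge> 0" for t
    by (rule above_barrier[OF DERIV_minus[OF d], where \<delta> = 1])
       (use that \<open>s > 0\<close> in \<open>auto simp: \<gamma>0 W_def inner\<close>)
  ultimately have "W (\<gamma> t) = V (\<gamma> t)" "fst (\<gamma> t) \<ge> 0" if "t \<ge> 0" for t
    using that by (auto simp: W_def min_absorb1)
  with \<gamma> \<gamma>0 show ?thesis
    unfolding solution_forward_def by metis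
qed

text \<open>
  Along a solution \<open>s\<close> decreases. If it stayed above some \<open>e > 0\<close>, the solution would live over the
  annulus \<open>e \<le> s \<le> s 0\<close>, which is compact because \<open>\<theta>\<close> matters only modulo \<open>2 * pi\<close>; there \<open>s\<close>
  decreases at a rate bounded away from zero and would become negative in finite time.
  Periodicity is expressed through the representative \<open>Arg (cis \<theta>)\<close>, which lies in \<open>{- pi..pi}\<close>.
\<close>

lemma solution_forward_tendsto_0:
  assumes sol: "solution_forward V \<gamma>" and start: "fst (\<gamma> 0) < \<epsilon>"
    and cont: "continuous_on UNIV V"
    and periodic: "\<And>s \<theta>. V (s, \<theta>) = V (s, Arg (cis \<theta>))"
    and neg: "\<And>s \<theta>. 0 < s \<Longrightarrow> s < \<epsilon> \<Longrightarrow> fst (V (s, \<theta>)) < 0"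
    and inv: "\<And>\<theta>. fst (V (0, \<theta>)) = 0"
  shows "((\<lambda>t. fst (\<gamma> t)) \<longlongrightarrow> 0) at_top"
proof -
  define s where "s t = fst (\<gamma> t)" for t
  have s_nonneg: "s t \<ge> 0" if "t \<ge> 0" for t
    using sol that by (simp add: solution_forward_def s_def)
  have deriv: "(s has_real_derivative fst (V (\<gamma> t))) (at t within {0..})" if "t \<ge> 0" for t
    using sol that unfolding s_def[abs_def] solution_forward_def
    by (auto intro: has_real_derivative_fst)
  have le: "fst (V (\<gamma> t)) \<le> 0" if "t \<ge> 0" "s t < \<epsilon>" for t
    using neg[of "s t" "snd (\<gamma> t)"] inv[of "snd (\<gamma> t)"] s_nonneg[of t] that
    by (cases "\<gamma> t"; cases "s t = 0") (auto simp: s_def)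
  have s_le: "s t \<le> s 0" if "t \<ge> 0" for t
  proof -
    have "- s t \<ge> - s 0"
      by (rule above_barrier[OF DERIV_minus[OF deriv], where \<delta> = "\<epsilon> - s 0"])
         (use that start le in \<open>auto simp: s_def\<close>)
    then show ?thesis by simp
  qed
  have mvt: "\<exists>u\<in>{a<..<b}. s b - s a = fst (V (\<gamma> u)) * (b - a)" if "0 \<le> a" "a < b" for a b
  proof (rule mvt_simple[OF \<open>a < b\<close>])
    fix u assume "a \<le> u" "u \<le> b"
    then show "(s has_derivative (*) (fst (V (\<gamma> u)))) (at u within {a..b})"
      using deriv[of u] \<open>0 \<le> a\<close> by (auto simp: has_field_derivative_def intro: has_derivative_subset)
  qed
  have antimono: "s b \<le> s a" if ab: "0 \<le> a" "a \<le> b" for a b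
  proof (cases "a = b")
    case False
    then obtain u where u: "a < u" "u < b" "s b - s a = fst (V (\<gamma> u)) * (b - a)"
      using mvt[of a b] ab by auto
    have "fst (V (\<gamma> u)) \<le> 0"
      using u ab s_le[of u] start by (intro le) (auto simp: s_def)
    then have "s b - s a \<le> 0" using u by (simp add: mult_nonpos_nonneg)
    then show ?thesis by simp
  qed auto
  have below: "\<exists>t\<ge>0. s t < e" if "e > 0" for e
  proof (rule ccontr)
    assume "\<not> (\<exists>t\<ge>0. s t < e)"
    then have ge: "s t \<ge> e" if "t \<ge> 0" for t using that by force
    define K where "K = {e..s 0} \<times> {- pi..pi}"
    have "compact K" unfolding K_def by (intro compact_Times compact_Icc)
    moreover have "(s 0, 0) \<in> K" using ge[of 0] by (simp add: K_def)
    moreover have "continuous_on K (\<lambda>z. fst (V z))"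
      by (intro continuous_intros continuous_on_subset[OF cont]) auto
    ultimately obtain z where "z \<in> K" and z_max: "\<And>w. w \<in> K \<Longrightarrow> fst (V w) \<le> fst (V z)"
      using continuous_attains_sup[of K "\<lambda>z. fst (V z)"] by blast
    define \<kappa> where "\<kappa> = - fst (V z)"
    have "\<kappa> > 0"
      using neg[of "fst z" "snd z"] \<open>z \<in> K\<close> \<open>e > 0\<close> start by (auto simp: \<kappa>_def K_def s_def)
    have speed: "fst (V (\<gamma> t)) \<le> - \<kappa>" if "t \<ge> 0" for t
    proof -
      have "(s t, Arg (cis (snd (\<gamma> t)))) \<in> K"
        using ge[OF that] s_le[OF that] Arg_bounded[of "cis (snd (\<gamma> t))"] by (auto simp: K_def)
      from z_max[OF this] show ?thesis
        using periodic[of "s t" "snd (\<gamma> t)"] by (simp add: s_def \<kappa>_def)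
    qed
    \<comment> \<open>A time by which \<open>s\<close> would have dropped to at most \<open>- \<kappa>\<close>.\<close>
    define T where "T = s 0 / \<kappa> + 1"
    have "T > 0" using \<open>\<kappa> > 0\<close> s_nonneg[of 0] by (simp add: T_def add_nonneg_pos)
    then obtain u where u: "0 < u" "u < T" "s T - s 0 = fst (V (\<gamma> u)) * T"
      using mvt[of 0 T] by auto
    then have "s T \<le> s 0 - \<kappa> * T"
      using speed[of u] mult_right_mono[of "fst (V (\<gamma> u))" "- \<kappa>" T] by auto
    also have "\<kappa> * T = s 0 + \<kappa>"
      using \<open>\<kappa> > 0\<close> by (simp add: T_def field_simps)
    finally show False
      using s_nonneg[of T] \<open>T > 0\<close> \<open>\<kappa> > 0\<close> by simp
  qed
  have "(s \<longlongrightarrow> 0) at_top"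
  proof (rule tendstoI)
    fix e :: real assume "e > 0"
    then obtain t where "t \<ge> 0" "s t < e" using below by blast
    then have "dist (s u) 0 < e" if "u \<ge> t" for u
      using antimono[of t u] s_nonneg[of u] that by auto
    then show "\<forall>\<^sub>F u in at_top. dist (s u) 0 < e"
      by (auto simp: eventually_at_top_linorder)
  qed
  then show ?thesis by (simp add: s_def[abs_def])
qed

section \<open>Zeros of the angular component at infinity\<close>

text \<open>
  The dehomogenisation \<open>p\<^sub>d(1, t)\<close> of the part of degree \<open>d\<close>; on the unit circle the variable \<open>t\<close>
  is \<open>tan \<theta>\<close>.
\<close>

definition tangent_poly :: "real poly poly \<Rightarrow> nat \<Rightarrow> real poly" where
  "tangent_poly p d = (\<Sum>j\<le>d. monom (coeff (coeff p j) (d - j)) j)"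

lemma coeff_tangent_poly:
  "coeff (tangent_poly p d) j = (if j \<le> d then coeff (coeff p j) (d - j) else 0)"
  by (simp add: tangent_poly_def coeff_sum)

lemma homogeneous_part_tangent:
  assumes "cos \<theta> \<noteq> 0"
  shows "homogeneous_part p d (cos \<theta>) (sin \<theta>) = cos \<theta> ^ d * poly (tangent_poly p d) (tan \<theta>)"
proof -
  have "homogeneous_part p d (cos \<theta> * 1) (cos \<theta> * tan \<theta>) = cos \<theta> ^ d * homogeneous_part p d 1 (tan \<theta>)"
    by (rule homogeneous_part_scale)
  then show ?thesis
    using assms by (simp add: tan_def tangent_poly_def homogeneous_part_def poly_sum poly_monom)
qed

lemma homogeneous_part_vertical:
  "homogeneous_part p d 0 y = coeff (coeff p d) 0 * y ^ d"
proof -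
  have "homogeneous_part p d 0 y = (\<Sum>j\<le>d. if j = d then coeff (coeff p d) 0 * y ^ d else 0)"
    unfolding homogeneous_part_def by (intro sum.cong) (auto simp: power_0_left)
  then show ?thesis by simp
qed

lemma homogeneous_part_vanishes_on_circle:
  assumes "\<And>\<theta>. homogeneous_part p d (cos \<theta>) (sin \<theta>) = 0" and "j \<le> d"
  shows "coeff (coeff p j) (d - j) = 0"
proof -
  have "poly (tangent_poly p d) t = 0" for t
    using assms(1)[of "arctan t"] homogeneous_part_tangent[of "arctan t" p d]
    by (simp add: cos_arctan_not_zero tan_arctan)
  then have "tangent_poly p d = 0" using poly_all_0_iff_0 by blast
  with \<open>j \<le> d\<close> show ?thesis
    using coeff_tangent_poly[of p d j] by simp
qed

lemma homogeneous_part_above_total_degree: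
  "total_degree p < d \<Longrightarrow> homogeneous_part p d x y = 0"
  by (auto simp: homogeneous_part_def coeff_eq_0_total_degree intro!: sum.neutral)

lemma total_degree_attained:
  assumes "total_degree p > 0"
  obtains i j where "i + j = total_degree p" "coeff (coeff p j) i \<noteq> 0"
proof -
  have "total_degree p \<in> insert 0 {i + j |i j. coeff (coeff p j) i \<noteq> 0}"
    unfolding total_degree_def by (intro Max_in) (simp_all add: finite_monomials)
  with assms that show thesis by auto
qed

lemma G_fun_eq_xi: "G_fun P Q \<theta> = xi P Q (int (system_degree P Q) - 1) \<theta>"
  by (simp add: G_fun_def xi_def)

text \<open>
  Passing to the radial and angular components is a rotation, hence preserves \<open>p\<^sup>2 + q\<^sup>2\<close>.
\<close>

lemma polar_components_determine:
  fixes \<theta> p q :: real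
  assumes "cos \<theta> * p + sin \<theta> * q = 0" and "cos \<theta> * q - sin \<theta> * p = 0"
  shows "p = 0 \<and> q = 0"
proof -
  have "(cos \<theta>)\<^sup>2 * (p\<^sup>2 + q\<^sup>2) + (sin \<theta>)\<^sup>2 * (p\<^sup>2 + q\<^sup>2)
      = (cos \<theta> * p + sin \<theta> * q)\<^sup>2 + (cos \<theta> * q - sin \<theta> * p)\<^sup>2"
    by (simp add: power2_eq_square algebra_simps)
  also have "\<dots> = 0" unfolding assms by simp
  finally have "((cos \<theta>)\<^sup>2 + (sin \<theta>)\<^sup>2) * (p\<^sup>2 + q\<^sup>2) = 0"
    unfolding distrib_right .
  then show ?thesis by (simp add: sum_power2_eq_zero_iff)
qed

text \<open>
  If both polar components of the part of degree \<open>m\<close> vanish, then so do \<open>P\<^sub>m\<close> and \<open>Q\<^sub>m\<close> on the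
  circle, hence all their coefficients, which contradicts the choice of \<open>m\<close>. For \<open>m = 0\<close> this fails:
  the degree of the zero system is also \<open>0\<close>.
\<close>

lemma top_degree_part_nonzero:
  assumes "system_degree P Q > 0"
  shows "\<exists>\<theta>. eta P Q (system_degree P Q) \<theta> \<noteq> 0 \<or> G_fun P Q \<theta> \<noteq> 0"
proof (rule ccontr)
  let ?m = "system_degree P Q"
  assume "\<not> ?thesis"
  then have "homogeneous_part P ?m (cos \<theta>) (sin \<theta>) = 0 \<and> homogeneous_part Q ?m (cos \<theta>) (sin \<theta>) = 0"
    for \<theta>
    by (intro polar_components_determine[of \<theta>]) (auto simp: eta_def G_fun_def)
  then have zero: "coeff (coeff P j) (?m - j) = 0" "coeff (coeff Q j) (?m - j) = 0" if "j \<le> ?m" for j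
    using that by (auto intro: homogeneous_part_vanishes_on_circle)
  consider "?m = total_degree P" | "?m = total_degree Q"
    unfolding system_degree_def by linarith
  then show False
  proof cases
    case 1
    then obtain i j where "i + j = ?m" "coeff (coeff P j) i \<noteq> 0"
      using total_degree_attained[of P] assms by metis
    then show False using zero(1)[of j] by (metis add_diff_cancel_right' le_add2)
  next
    case 2
    then obtain i j where "i + j = ?m" "coeff (coeff Q j) i \<noteq> 0"
      using total_degree_attained[of Q] assms by metis
    then show False using zero(2)[of j] by (metis add_diff_cancel_right' le_add2)
  qed
qed

lemma radial_order_le:
  assumes "is_radial_order P Q I" shows "I \<le> system_degree P Q"
proof (rule ccontr)
  assume "\<not> I \<le> system_degree P Q"
  then have "eta P Q I \<theta> = 0" for \<theta>
    by (simp add: eta_def homogeneous_part_above_total_degree system_degree_def)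
  with assms show False by (auto simp: is_radial_order_def)
qed

lemma angular_order_le:
  assumes "is_angular_order P Q J" shows "J \<le> int (system_degree P Q) - 1"
proof (rule ccontr)
  assume "\<not> J \<le> int (system_degree P Q) - 1"
  then have "nat (J + 1) > total_degree P" "nat (J + 1) > total_degree Q"
    by (auto simp: system_degree_def)
  then have "xi P Q J \<theta> = 0" for \<theta>
    by (simp add: xi_def homogeneous_part_above_total_degree)
  with assms show False by (auto simp: is_angular_order_def)
qed

text \<open>
  The radial order is at most \<open>m\<close> and the angular order at most \<open>m - 1\<close>; since \<open>P\<^sub>m\<close> and \<open>Q\<^sub>m\<close> do not
  both vanish, at least one of these bounds is attained. The angular one is attained exactly if
  \<open>G\<^sub>m\<^sub>+\<^sub>1\<close> is not identically zero. So \<open>I - J \<le> 1\<close> in that case, whereas otherwise \<open>I = m\<close>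
  and \<open>J \<le> m - 2\<close>.
\<close>

lemma G_fun_identically_zero_iff:
  assumes I: "is_radial_order P Q I" and J: "is_angular_order P Q J"
  shows "(\<forall>\<theta>. G_fun P Q \<theta> = 0) \<longleftrightarrow> int I - J \<ge> 2"
proof
  let ?m = "system_degree P Q"
  assume G: "\<forall>\<theta>. G_fun P Q \<theta> = 0"
  have "J \<noteq> int ?m - 1"
    using G J by (auto simp: G_fun_eq_xi is_angular_order_def)
  \<comment> \<open>A lower bound on \<open>m\<close> comes from \<open>-1 \<le> J < m - 1\<close>; it excludes the degenerate zero system.\<close>
  then have "J < int ?m - 1" using angular_order_le[OF J] by simp
  moreover have "J \<ge> -1" using J by (simp add: is_angular_order_def)
  ultimately have "?m > 0" by linarith
  then have "\<exists>\<theta>. eta P Q ?m \<theta> \<noteq> 0" using top_degree_part_nonzero G by blast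
  then have "I = ?m"
    using I radial_order_le[OF I] unfolding is_radial_order_def by (metis le_neq_implies_less)
  then show "int I - J \<ge> 2" using \<open>J < int ?m - 1\<close> by linarith
next
  assume "int I - J \<ge> 2"
  then have "J < int (system_degree P Q) - 1"
    using radial_order_le[OF I] by linarith
  then show "\<forall>\<theta>. G_fun P Q \<theta> = 0"
    using J by (simp add: G_fun_eq_xi is_angular_order_def)
qed

text \<open>
  Away from \<open>cos \<theta> = 0\<close>, the function \<open>G\<^sub>m\<^sub>+\<^sub>1(\<theta>)\<close> is \<open>cos \<theta> ^ (m + 1)\<close> times a polynomial \<open>g\<close> in
  \<open>tan \<theta>\<close>. Each of the finitely many roots of \<open>g\<close> is the slope of one line through the origin, which
  meets the unit circle in two points. That \<open>g\<close> is not zero also uses the vertical direction: there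
  \<open>G\<^sub>m\<^sub>+\<^sub>1\<close> is a multiple of the coefficient of degree \<open>m + 1\<close> of \<open>g\<close>.
\<close>

lemma finite_zeros_of_G_fun:
  assumes "\<exists>\<theta>. G_fun P Q \<theta> \<noteq> 0"
  shows "finite {(cos \<theta>, sin \<theta>) |\<theta>. G_fun P Q \<theta> = 0}"
proof -
  define m where "m = system_degree P Q"
  define g where "g = tangent_poly Q m - pCons 0 (tangent_poly P m)"
  have G_tan: "G_fun P Q \<theta> = cos \<theta> ^ Suc m * poly g (tan \<theta>)" if "cos \<theta> \<noteq> 0" for \<theta>
    unfolding G_fun_def m_def[symmetric] homogeneous_part_tangent[OF that] g_def
    using that by (simp add: tan_def algebra_simps)
  have "g \<noteq> 0"
  proof
    assume "g = 0"
    then have "coeff g (Suc m) = 0" by simp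
    then have "coeff (coeff P m) 0 = 0"
      by (simp add: g_def coeff_tangent_poly)
    then have "G_fun P Q \<theta> = 0" for \<theta>
      using G_tan[of \<theta>] \<open>g = 0\<close>
      by (cases "cos \<theta> = 0") (simp_all add: G_fun_def homogeneous_part_vertical flip: m_def)
    with assms show False by blast
  qed
  \<comment> \<open>The point of the circle on the line of slope \<open>t\<close> whose first coordinate has the sign \<open>\<sigma>\<close>.\<close>
  define \<phi> :: "real \<times> real \<Rightarrow> real \<times> real"
    where "\<phi> = (\<lambda>(\<sigma>, t). (\<sigma> / sqrt (1 + t\<^sup>2), t * (\<sigma> / sqrt (1 + t\<^sup>2))))"
  have "{(cos \<theta>, sin \<theta>) |\<theta>. G_fun P Q \<theta> = 0}
      \<subseteq> {(0, 1), (0, -1)} \<union> \<phi> ` ({1, -1} \<times> {t. poly g t = 0})"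
  proof
    fix w assume "w \<in> {(cos \<theta>, sin \<theta>) |\<theta>. G_fun P Q \<theta> = 0}"
    then obtain \<theta> where w: "w = (cos \<theta>, sin \<theta>)" and G: "G_fun P Q \<theta> = 0" by blast
    show "w \<in> {(0, 1), (0, -1)} \<union> \<phi> ` ({1, -1} \<times> {t. poly g t = 0})"
    proof (cases "cos \<theta> = 0")
      case True
      then have "(sin \<theta>)\<^sup>2 = 1" using sin_cos_squared_add[of \<theta>] by simp
      then show ?thesis using True by (auto simp: w power2_eq_1_iff)
    next
      case False
      then have root: "poly g (tan \<theta>) = 0" using G G_tan by simp
      have "sqrt (1 + (tan \<theta>)\<^sup>2) = 1 / \<bar>cos \<theta>\<bar>"
        using tan_sec[OF False] by (simp add: inverse_eq_divide)
      then have "sgn (cos \<theta>) / sqrt (1 + (tan \<theta>)\<^sup>2) = cos \<theta>"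
        by (simp add: sgn_mult_abs)
      moreover have "tan \<theta> * cos \<theta> = sin \<theta>"
        using False by (simp add: tan_def)
      ultimately have "\<phi> (sgn (cos \<theta>), tan \<theta>) = w"
        by (simp only: \<phi>_def w prod.case)
      moreover have "sgn (cos \<theta>) \<in> {1, -1}" using False by (simp add: sgn_if)
      ultimately show ?thesis using root by (force intro: rev_image_eqI)
    qed
  qed
  moreover have "finite (\<phi> ` ({1, -1} \<times> {t. poly g t = 0}))"
    using poly_roots_finite[OF \<open>g \<noteq> 0\<close>] by simp
  ultimately show ?thesis
    by (meson finite.emptyI finite.insertI finite_UnI finite_subset)
qed

text \<open>
  At \<open>s = 0\<close> only the terms without a factor \<open>s\<close> survive; the radial component has none, and the
  angular one just the term of degree \<open>m\<close>.
\<close>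

lemma smooth_field_equator: "smooth_field P Q (0, \<theta>) = (0, G_fun P Q \<theta>)"
proof -
  let ?m = "system_degree P Q"
  have "(\<Sum>i\<le>?m. 0 ^ (?m - i) * xi P Q (int i - 1) \<theta>)
      = (\<Sum>i\<le>?m. if i = ?m then xi P Q (int ?m - 1) \<theta> else 0)"
    by (intro sum.cong) (auto simp: power_0_left)
  moreover have "(\<Sum>i\<le>?m. 0 ^ (?m + 1 - i) * eta P Q i \<theta>) = 0"
    by (intro sum.neutral) (auto simp: power_0_left)
  ultimately show ?thesis
    by (simp add: smooth_field_def G_fun_eq_xi)
qed

lemma fixed_points_at_infinity_eq:
  "fixed_points_at_infinity P Q = {(cos \<theta>, sin \<theta>) |\<theta>. G_fun P Q \<theta> = 0}"
  by (simp add: fixed_points_at_infinity_def extended_field_eq smooth_field_equator)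

section \<open>Trajectories near the equator\<close>

lemma trajectory_on_forward_iff:
  "trajectory_on P Q {0..} \<gamma> \<longleftrightarrow> solution_forward (smooth_field P Q) \<gamma>"
  unfolding trajectory_on_def solution_forward_def Ball_def atLeast_iff
  by (intro iff_allI imp_cong conj_cong refl) (simp add: extended_field_eq)

lemma has_vector_derivative_reflect:
  assumes "(\<gamma> has_vector_derivative v) (at (- t) within uminus ` S)"
  shows "((\<lambda>t. \<gamma> (- t)) has_vector_derivative - v) (at t within S)"
proof -
  have "(uminus has_vector_derivative - 1) (at t within S)"
    by (auto intro!: derivative_eq_intros)
  from vector_diff_chain_within[OF this assms] show ?thesis
    by (simp add: comp_def)
qed

lemma trajectory_on_backward_iff:
  "trajectory_on P Q {..0} \<gamma> \<longleftrightarrow> solution_forward (\<lambda>z. - smooth_field P Q z) (\<lambda>t. \<gamma> (- t))"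
proof
  assume \<gamma>: "trajectory_on P Q {..0} \<gamma>"
  show "solution_forward (\<lambda>z. - smooth_field P Q z) (\<lambda>t. \<gamma> (- t))"
    unfolding solution_forward_def
  proof (intro allI impI conjI)
    fix t :: real assume "t \<ge> 0"
    then have *: "fst (\<gamma> (- t)) \<ge> 0"
      "(\<gamma> has_vector_derivative extended_field P Q (\<gamma> (- t))) (at (- t) within {..0})"
      using bspec[OF \<gamma>[unfolded trajectory_on_def], of "- t"] by simp_all
    then show "fst (\<gamma> (- t)) \<ge> 0" by blast
    from * show "((\<lambda>t. \<gamma> (- t)) has_vector_derivative - smooth_field P Q (\<gamma> (- t)))
        (at t within {0..})"
      by (intro has_vector_derivative_reflect) (simp add: extended_field_eq)
  qed
next
  assume \<gamma>: "solution_forward (\<lambda>z. - smooth_field P Q z) (\<lambda>t. \<gamma> (- t))"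
  show "trajectory_on P Q {..0} \<gamma>"
    unfolding trajectory_on_def
  proof (intro ballI conjI)
    fix t :: real assume "t \<in> {..0}"
    then have "fst (\<gamma> (- (- t))) \<ge> 0"
      using \<gamma> unfolding solution_forward_def by (metis atMost_iff neg_0_le_iff_le)
    then show "fst (\<gamma> t) \<ge> 0" by simp
    have "((\<lambda>t. \<gamma> (- t)) has_vector_derivative - smooth_field P Q (\<gamma> (- (- t))))
        (at (- t) within uminus ` {..0})"
      using \<gamma> \<open>t \<in> {..0}\<close> unfolding solution_forward_def image_uminus_atMost
      by (metis atMost_iff minus_zero neg_0_le_iff_le)
    from has_vector_derivative_reflect[OF this]
    show "(\<gamma> has_vector_derivative extended_field P Q (\<gamma> t)) (at t within {..0})"
      using \<open>fst (\<gamma> t) \<ge> 0\<close> by (simp add: extended_field_eq)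
  qed
qed

lemma bounded_Lipschitz_clamped_smooth_field:
  "bounded_Lipschitz (\<lambda>z. smooth_field P Q (max 0 (min (fst z) c), snd z))"
  unfolding smooth_field_def prod.case eta_def xi_def homogeneous_part_def
  by (intro bounded_Lipschitz_intros)

lemma smooth_field_periodic: "smooth_field P Q (s, \<theta>) = smooth_field P Q (s, Arg (cis \<theta>))"
proof -
  have "cis (Arg (cis \<theta>)) = cis \<theta>"
    by (subst cis_Arg) (auto simp: sgn_eq)
  then have "cos (Arg (cis \<theta>)) = cos \<theta>" "sin (Arg (cis \<theta>)) = sin \<theta>"
    by (auto simp: complex_eq_iff)
  then show ?thesis by (simp add: smooth_field_def eta_def xi_def)
qed

lemma fst_smooth_field:
  assumes "s > 0"
  shows "fst (smooth_field P Q (s, \<theta>))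
    = - (s powi (int (system_degree P Q) - 1) * s\<^sup>2) * radial_speed P Q (1 / s) \<theta>"
  using rescaled_field_eq[OF assms, of P Q \<theta>, symmetric] by (simp add: rescaled_field_def)

text \<open>
  The exterior region \<open>r \<ge> R\<close> is connected, so a continuous function without zeros has one
  sign on it.
\<close>

lemma radial_speed_constant_sign:
  assumes "\<And>r \<theta>. r \<ge> R \<Longrightarrow> radial_speed P Q r \<theta> \<noteq> 0"
  shows "(\<forall>r \<theta>. r \<ge> R \<longrightarrow> radial_speed P Q r \<theta> > 0) \<or> (\<forall>r \<theta>. r \<ge> R \<longrightarrow> radial_speed P Q r \<theta> < 0)"
proof (rule ccontr)
  assume "\<not> ?thesis"
  then obtain r1 \<theta>1 r2 \<theta>2 where le: "r1 \<ge> R" "r2 \<ge> R"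
    and sg: "radial_speed P Q r1 \<theta>1 \<le> 0" "0 \<le> radial_speed P Q r2 \<theta>2"
    by (auto simp: not_less)
  let ?f = "\<lambda>z. radial_speed P Q (fst z) (snd z)" and ?A = "{R..} \<times> (UNIV :: real set)"
  have "connected (?f ` ?A)"
  proof (rule connected_continuous_image)
    show "continuous_on ?A ?f"
      unfolding radial_speed_eq eta_def homogeneous_part_def by (intro continuous_intros)
    show "connected ?A" by (intro convex_connected convex_Times) auto
  qed
  moreover have "?f (r1, \<theta>1) \<in> ?f ` ?A" "?f (r2, \<theta>2) \<in> ?f ` ?A"
    using le by (intro imageI; simp)+
  ultimately have "0 \<in> ?f ` ?A"
    by (rule connectedD_interval) (use sg in simp_all)
  with assms show False by force
qed

text \<open>
  Near the equator \<open>ds/d\<tau>\<close> is a negative multiple of \<open>dr/dt\<close>. If \<open>dr/dt > 0\<close> for large \<open>r\<close>, then \<open>s\<close>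
  decreases to zero in forward time; if \<open>dr/dt < 0\<close>, the same argument applied to the negative of the field
  shows that \<open>s\<close> decreases to zero in backward time.
\<close>

lemma limit_cycle_at_infinity_if_radial_speed_nonzero:
  assumes "cycle_at_infinity P Q"
    and nonzero: "\<And>r \<theta>. r > 0 \<Longrightarrow> r \<ge> R \<Longrightarrow> radial_speed P Q r \<theta> \<noteq> 0"
  shows "limit_cycle_at_infinity P Q"
proof -
  define R0 where "R0 = max R 1"
  define \<epsilon> where "\<epsilon> = 1 / R0"
  have "R0 > 0" "\<epsilon> > 0" by (auto simp: R0_def \<epsilon>_def)
  have large: "1 / s \<ge> R0" if "0 < s" "s < \<epsilon>" for s
    using that \<open>R0 > 0\<close> by (simp add: \<epsilon>_def field_simps)
  have weight: "s powi (int (system_degree P Q) - 1) * s\<^sup>2 > 0" if "s > 0" for s :: real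
    using that by (intro mult_pos_pos zero_less_power_int zero_less_power)
  note equator = smooth_field_equator[of P Q]
  note lip = bounded_Lipschitz_clamped_smooth_field[of P Q]
  have cont: "continuous_on UNIV (smooth_field P Q)" by (rule continuous_on_smooth_field)
  have "(\<forall>r \<theta>. r \<ge> R0 \<longrightarrow> radial_speed P Q r \<theta> > 0) \<or>
        (\<forall>r \<theta>. r \<ge> R0 \<longrightarrow> radial_speed P Q r \<theta> < 0)"
    by (rule radial_speed_constant_sign) (use nonzero in \<open>auto simp: R0_def\<close>)
  then have "(\<forall>s \<theta>. 0 < s \<and> s < \<epsilon> \<longrightarrow> approaches_equator_forward P Q (s, \<theta>)) \<or>
    (\<forall>s \<theta>. 0 < s \<and> s < \<epsilon> \<longrightarrow> approaches_equator_backward P Q (s, \<theta>))"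
  proof (elim disjE)
    assume pos: "\<forall>r \<theta>. r \<ge> R0 \<longrightarrow> radial_speed P Q r \<theta> > 0"
    have neg: "fst (smooth_field P Q (s, \<theta>)) < 0" if "0 < s" "s < \<epsilon>" for s \<theta>
      using mult_pos_pos[OF weight[OF that(1)], of "radial_speed P Q (1 / s) \<theta>"] pos large[OF that]
      unfolding fst_smooth_field[OF that(1)] by simp
    have "approaches_equator_forward P Q (s, \<theta>)" if s: "0 < s" "s < \<epsilon>" for s \<theta>
      unfolding approaches_equator_forward_def trajectory_on_forward_iff
    proof (intro conjI allI impI)
      show "\<exists>\<gamma>. solution_forward (smooth_field P Q) \<gamma> \<and> \<gamma> 0 = (s, \<theta>)"
        by (rule solution_forward_exists[OF lip]) (use neg s in \<open>auto simp: equator less_imp_le\<close>)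
      fix \<gamma> assume "solution_forward (smooth_field P Q) \<gamma> \<and> \<gamma> 0 = (s, \<theta>)"
      then have \<gamma>: "solution_forward (smooth_field P Q) \<gamma>" "fst (\<gamma> 0) < \<epsilon>"
        using s by auto
      show "((\<lambda>\<tau>. fst (\<gamma> \<tau>)) \<longlongrightarrow> 0) at_top"
        by (rule solution_forward_tendsto_0[OF \<gamma> cont smooth_field_periodic neg])
           (simp_all add: equator)
    qed
    then show ?thesis by blast
  next
    let ?V = "\<lambda>z. - smooth_field P Q z"
    assume neg: "\<forall>r \<theta>. r \<ge> R0 \<longrightarrow> radial_speed P Q r \<theta> < 0"
    have neg: "fst (?V (s, \<theta>)) < 0" if "0 < s" "s < \<epsilon>" for s \<theta>
      using mult_pos_neg[OF weight[OF that(1)], of "radial_speed P Q (1 / s) \<theta>"] neg large[OF that]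
      unfolding fst_uminus fst_smooth_field[OF that(1)] by simp
    have lip': "bounded_Lipschitz (\<lambda>z. ?V (max 0 (min (fst z) c), snd z))" for c
      by (rule bounded_Lipschitz_minus[OF lip])
    have cont': "continuous_on UNIV ?V" by (intro continuous_intros cont)
    have periodic': "?V (s, \<theta>) = ?V (s, Arg (cis \<theta>))" for s \<theta>
      by (rule arg_cong[OF smooth_field_periodic])
    have "approaches_equator_backward P Q (s, \<theta>)" if s: "0 < s" "s < \<epsilon>" for s \<theta>
      unfolding approaches_equator_backward_def trajectory_on_backward_iff
    proof (intro conjI allI impI)
      have "\<exists>\<gamma>. solution_forward ?V \<gamma> \<and> \<gamma> 0 = (s, \<theta>)"
        by (rule solution_forward_exists[OF lip']) (use neg s in \<open>auto simp: equator less_imp_le\<close>)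
      then obtain \<gamma> where "solution_forward ?V \<gamma>" "\<gamma> 0 = (s, \<theta>)" by blast
      then show "\<exists>\<gamma>. solution_forward ?V (\<lambda>t. \<gamma> (- t)) \<and> \<gamma> 0 = (s, \<theta>)"
        by (intro exI[of _ "\<lambda>t. \<gamma> (- t)"]) simp
      fix \<gamma> assume "solution_forward ?V (\<lambda>t. \<gamma> (- t)) \<and> \<gamma> 0 = (s, \<theta>)"
      then have \<gamma>: "solution_forward ?V (\<lambda>t. \<gamma> (- t))" "fst (\<gamma> (- 0)) < \<epsilon>"
        using s by auto
      have "((\<lambda>\<tau>. fst (\<gamma> (- \<tau>))) \<longlongrightarrow> 0) at_top"
        by (rule solution_forward_tendsto_0[OF \<gamma> cont' periodic' neg]) (simp_all add: equator)
      then show "((\<lambda>\<tau>. fst (\<gamma> \<tau>)) \<longlongrightarrow> 0) at_bot"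
        by (simp add: filterlim_at_bot_mirror)
    qed
    then show ?thesis by blast
  qed
  with assms(1) \<open>\<epsilon> > 0\<close> show ?thesis
    unfolding limit_cycle_at_infinity_def by blast
qed

section \<open>The equator of the Poincare sphere\<close>

theorem theorem2:
  fixes P Q :: "real poly poly" and I :: nat and J k :: int
  assumes "is_radial_order P Q I"
    and "is_angular_order P Q J"
    and "k = int I - J"
  shows "(k \<ge> 2 \<longrightarrow> fixed_points_at_infinity P Q = equator) \<and>
    (k \<le> 1 \<longrightarrow>
      ((\<forall>\<theta>. G_fun P Q \<theta> \<noteq> 0) \<longrightarrow>
        cycle_at_infinity P Q \<and>
        ((\<exists>R. \<forall>r \<theta>. r > 0 \<and> r \<ge> R \<longrightarrow> radial_speed P Q r \<theta> \<noteq> 0) \<longrightarrow>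
          limit_cycle_at_infinity P Q)) \<and>
      (\<not> (\<forall>\<theta>. G_fun P Q \<theta> \<noteq> 0) \<longrightarrow>
        finite (fixed_points_at_infinity P Q) \<and>
        fixed_points_at_infinity P Q = {(cos \<theta>, sin \<theta>) |\<theta>. G_fun P Q \<theta> = 0}))"
proof (intro conjI impI)
  have k: "(\<forall>\<theta>. G_fun P Q \<theta> = 0) \<longleftrightarrow> k \<ge> 2"
    unfolding assms(3) by (rule G_fun_identically_zero_iff[OF assms(1,2)])
  show "fixed_points_at_infinity P Q = equator" if "k \<ge> 2"
    using k that by (auto simp: fixed_points_at_infinity_eq equator_def)
  show cycle: "cycle_at_infinity P Q" if "\<forall>\<theta>. G_fun P Q \<theta> \<noteq> 0"
    using that by (simp add: cycle_at_infinity_def fixed_points_at_infinity_eq)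
  show "limit_cycle_at_infinity P Q"
    if "\<forall>\<theta>. G_fun P Q \<theta> \<noteq> 0"
      and "\<exists>R. \<forall>r \<theta>. r > 0 \<and> r \<ge> R \<longrightarrow> radial_speed P Q r \<theta> \<noteq> 0"
    using that(2) limit_cycle_at_infinity_if_radial_speed_nonzero[OF cycle[OF that(1)]] by blast
  show "fixed_points_at_infinity P Q = {(cos \<theta>, sin \<theta>) |\<theta>. G_fun P Q \<theta> = 0}"
    by (rule fixed_points_at_infinity_eq)
  show "finite (fixed_points_at_infinity P Q)" if "k \<le> 1"
    unfolding fixed_points_at_infinity_eq using k that by (intro finite_zeros_of_G_fun) auto
qed

end
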